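(* Let $\lambda_t>0$, $\lambda_s>0$, and suppose that $D(\lambda_t,\lambda_s):=R(\lambda_t)+R_{\mathrm{pd}}(\lambda_s)-2C(\lambda_t,\lambda_s)$ is strictly positive. Let $\xi^\star(\lambda_t,\lambda_s)\in\arg\min_{\xi\in\mathbb R}R_{\mathsf{pmsd}}(\lambda_t,\lambda_s,\xi)$ and $R^\star_{\mathsf{pmsd}}(\lambda_t,\lambda_s):=R_{\mathsf{pmsd}}(\lambda_t,\lambda_s,\xi^\star(\lambda_t,\lambda_s))$. Then $$\xi^\star(\lambda_t,\lambda_s)=\frac{R(\lambda_t)-C(\lambda_t,\lambda_s)}{D(\lambda_t,\lambda_s)},$$ $$R^\star_{\mathsf{pmsd}}(\lambda_t,\lambda_s)=R(\lambda_t)-\frac{(R(\lambda_t)-C(\lambda_t,\lambda_s))^2}{D(\lambda_t,\lambda_s)}=R_{\mathrm{pd}}(\lambda_s)-\frac{(R_{\mathrm{pd}}(\lambda_s)-C(\lambda_t,\lambda_s))^2}{D(\lambda_t,\lambda_s)}.$$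
   Context: Labeled data $\mathcal D_{\rm lab}=(X,y)\in\mathbb R^{n_t\times p}\times\mathbb R^{n_t}$ consist of $n_t$ i.i.d. pairs $(x_i,y_i)$. Fresh unlabeled data $\mathcal D_{\rm unlab}=\tilde X\in\mathbb R^{n_s\times p}$ consist of $n_s$ i.i.d. covariate rows, possibly from another distribution. The teacher predictor is $f_{\lambda_t}(x)=x^\top\arg\min_{\beta\in\mathbb R^p}\{\|y-X\beta\|_2^2/n_t+\lambda_t\|\beta\|_2^2\}$. With pseudo-labels $\hat y_{\lambda_t}=f_{\lambda_t}(\tilde X)\in\mathbb R^{n_s}$ (teacher evaluated at each row of $\tilde X$), the pure-distilled (PD) student is $f_{\mathrm{pd},\lambda_s}(x)=x^\top\arg\min_{\beta\in\mathbb R^p}\{\|\hat y_{\lambda_t}-\tilde X\beta\|_2^2/n_s+\lambda_s\|\beta\|_2^2\}$. For $\xi\in\mathbb R$ the prediction-mixed (PMSD) student is $f_{\mathsf{pmsd},\lambda_t,\lambda_s,\xi}(x)=(1-\xi)f_{\lambda_t}(x)+\xi f_{\mathrm{pd},\lambda_s}(x)$. Let $(x_0,y_0)$ be an independent test point from the teacher's training distribution. For a predictor $f$, its conditional risk is $\mathbb E[(y_0-f(x_0))^2\mid\mathcal D_{\rm lab},\mathcal D_{\rm unlab}]$. Denote by $R(\lambda_t)$, $R_{\mathrm{pd}}(\lambda_s)$, $R_{\mathsf{pmsd}}(\lambda_t,\lambda_s,\xi)$ the conditional risks of $f_{\lambda_t}$, $f_{\mathrm{pd},\lambda_s}$, $f_{\mathsf{pmsd},\lambda_t,\lambda_s,\xi}$,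 respectively, and let $C(\lambda_t,\lambda_s)=\mathbb E[(y_0-f_{\lambda_t}(x_0))(y_0-f_{\mathrm{pd},\lambda_s}(x_0))\mid\mathcal D_{\rm lab},\mathcal D_{\rm unlab}]$. These conditional expectations are finite. *)

theory Defs
  imports "HOL-Probability.Probability"
begin

section \<open>Ridge teacher, pure-distilled and prediction-mixed students\<close>

text \<open>The sample sizes and the dimension of the covariates are the cardinalities of the index
  types: \<open>'n\<close> for labeled rows, \<open>'m\<close> for unlabeled rows, \<open>'p\<close> for covariates.\<close>

definition ridge_objective :: "real^'p^'n \<Rightarrow> real^'n \<Rightarrow> real \<Rightarrow> real^'p \<Rightarrow> real" where
  "ridge_objective A b l \<beta> = (norm (b - A *v \<beta>))\<^sup>2 / real CARD('n) + l * (norm \<beta>)\<^sup>2"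

definition ridge :: "real^'p^'n \<Rightarrow> real^'n \<Rightarrow> real \<Rightarrow> real^'p" where
  "ridge A b l = arg_min (ridge_objective A b l) (\<lambda>_. True)"

definition teacher :: "real \<Rightarrow> real^'p^'n \<Rightarrow> real^'n \<Rightarrow> real^'p \<Rightarrow> real" where
  "teacher lt X y x = x \<bullet> ridge X y lt"

definition pseudo_labels :: "real \<Rightarrow> real^'p^'n \<Rightarrow> real^'n \<Rightarrow> real^'p^'m \<Rightarrow> real^'m" where
  "pseudo_labels lt X y Xu = (\<chi> j. teacher lt X y (Xu $ j))"

definition pd_student ::
  "real \<Rightarrow> real \<Rightarrow> real^'p^'n \<Rightarrow> real^'n \<Rightarrow> real^'p^'m \<Rightarrow> real^'p \<Rightarrow> real" where
  "pd_student lt ls X y Xu x = x \<bullet> ridge Xu (pseudo_labels lt X y Xu) ls"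

definition pmsd_student ::
  "real \<Rightarrow> real \<Rightarrow> real \<Rightarrow> real^'p^'n \<Rightarrow> real^'n \<Rightarrow> real^'p^'m \<Rightarrow> real^'p \<Rightarrow> real" where
  "pmsd_student lt ls \<xi> X y Xu x = (1 - \<xi>) * teacher lt X y x + \<xi> * pd_student lt ls X y Xu x"


section \<open>The data model\<close>

definition data_algebra ::
  "'w measure \<Rightarrow> ('w \<Rightarrow> real^'p^'n) \<Rightarrow> ('w \<Rightarrow> real^'n) \<Rightarrow> ('w \<Rightarrow> real^'p^'m) \<Rightarrow> 'w measure" where
  "data_algebra M X y Xu = vimage_algebra (space M) (\<lambda>\<omega>. (X \<omega>, y \<omega>, Xu \<omega>)) borel"

text \<open>Independence of random variables with different codomains is stated through the generated
  sigma-algebras, because \<^const>\<open>prob_space.indep_var\<close> requires a common codomain type.\<close>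

locale distillation_model = prob_space M for M :: "'w measure" +
  fixes X :: "'w \<Rightarrow> real^'p^'n" and y :: "'w \<Rightarrow> real^'n" and Xu :: "'w \<Rightarrow> real^'p^'m"
    and x0 :: "'w \<Rightarrow> real^'p" and y0 :: "'w \<Rightarrow> real"
  assumes measurable_model [measurable]:
      "X \<in> borel_measurable M" "y \<in> borel_measurable M" "Xu \<in> borel_measurable M"
      "x0 \<in> borel_measurable M" "y0 \<in> borel_measurable M"
    and labeled_indep: "indep_vars (\<lambda>_. borel) (\<lambda>i \<omega>. (X \<omega> $ i, y \<omega> $ i)) UNIV"
    and labeled_test_ident:
      "\<And>i. distr M borel (\<lambda>\<omega>. (X \<omega> $ i, y \<omega> $ i)) = distr M borel (\<lambda>\<omega>. (x0 \<omega>, y0 \<omega>))"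
    and unlabeled_indep: "indep_vars (\<lambda>_. borel) (\<lambda>j \<omega>. Xu \<omega> $ j) UNIV"
    and unlabeled_ident:
      "\<And>j k. distr M borel (\<lambda>\<omega>. Xu \<omega> $ j) = distr M borel (\<lambda>\<omega>. Xu \<omega> $ k)"
    and unlabeled_fresh:
      "indep_set (sets (vimage_algebra (space M) (\<lambda>\<omega>. (X \<omega>, y \<omega>)) borel))
                 (sets (vimage_algebra (space M) Xu borel))"
    and test_indep:
      "indep_set (sets (data_algebra M X y Xu))
                 (sets (vimage_algebra (space M) (\<lambda>\<omega>. (x0 \<omega>, y0 \<omega>)) borel))"


section \<open>Conditional risks\<close>

text \<open>A predictor built from the data is a function \<open>f :: 'w \<Rightarrow> real^'p \<Rightarrow> real\<close>. Since
  \<^const>\<open>real_cond_exp\<close> is also defined, with arbitrary meaning, when the conditional expectation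
  is infinite, finiteness is stated by a separate predicate.\<close>

definition cond_cross_risk ::
  "'w measure \<Rightarrow> 'w measure \<Rightarrow> ('w \<Rightarrow> 'x) \<Rightarrow> ('w \<Rightarrow> real) \<Rightarrow> ('w \<Rightarrow> 'x \<Rightarrow> real) \<Rightarrow> ('w \<Rightarrow> 'x \<Rightarrow> real)
    \<Rightarrow> 'w \<Rightarrow> real" where
  "cond_cross_risk M F x0 y0 f g =
     real_cond_exp M F (\<lambda>\<omega>. (y0 \<omega> - f \<omega> (x0 \<omega>)) * (y0 \<omega> - g \<omega> (x0 \<omega>)))"

definition cond_risk ::
  "'w measure \<Rightarrow> 'w measure \<Rightarrow> ('w \<Rightarrow> 'x) \<Rightarrow> ('w \<Rightarrow> real) \<Rightarrow> ('w \<Rightarrow> 'x \<Rightarrow> real) \<Rightarrow> 'w \<Rightarrow> real" where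
  "cond_risk M F x0 y0 f = real_cond_exp M F (\<lambda>\<omega>. (y0 \<omega> - f \<omega> (x0 \<omega>))\<^sup>2)"

definition finite_cond_risk ::
  "'w measure \<Rightarrow> 'w measure \<Rightarrow> ('w \<Rightarrow> 'x) \<Rightarrow> ('w \<Rightarrow> real) \<Rightarrow> ('w \<Rightarrow> 'x \<Rightarrow> real) \<Rightarrow> bool" where
  "finite_cond_risk M F x0 y0 f \<longleftrightarrow>
     (AE \<omega> in M. nn_cond_exp M F (\<lambda>\<omega>. ennreal ((y0 \<omega> - f \<omega> (x0 \<omega>))\<^sup>2)) \<omega> < \<infinity>)"

text \<open>Conditional expectations are determined up to null sets only, so minimising
  \<open>\<xi> \<mapsto> E[(y0 - f \<xi> (x0))\<^sup>2 | F]\<close> over the uncountable set of all real \<open>\<xi>\<close> presupposes a choice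
  of versions. As usual it is one that is continuous in the parameter; any two such choices agree
  for all parameters simultaneously, outside a single null set.\<close>

definition continuous_cond_risk_version ::
  "'w measure \<Rightarrow> 'w measure \<Rightarrow> ('w \<Rightarrow> 'x) \<Rightarrow> ('w \<Rightarrow> real) \<Rightarrow> (real \<Rightarrow> 'w \<Rightarrow> 'x \<Rightarrow> real)
    \<Rightarrow> (real \<Rightarrow> 'w \<Rightarrow> real) \<Rightarrow> bool" where
  "continuous_cond_risk_version M F x0 y0 f V \<longleftrightarrow>
     (\<forall>\<xi>. AE \<omega> in M. V \<xi> \<omega> = cond_risk M F x0 y0 (f \<xi>) \<omega>) \<and>
     (AE \<omega> in M. continuous_on UNIV (\<lambda>\<xi>. V \<xi> \<omega>))"


section \<open>The ridge estimator is continuous in the data\<close>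

definition ridge_gram :: "real^'p^'n \<Rightarrow> real \<Rightarrow> real^'p^'p" where
  "ridge_gram A l = transpose A ** A + (real CARD('n) * l) *\<^sub>R mat 1"

lemma inner_transpose: "u \<bullet> (transpose A *v w) = ((A::real^'p^'n) *v u) \<bullet> w"
  by (metis dot_lmul_matrix vector_transpose_matrix)

lemma ridge_gram_vec:
  "ridge_gram (A::real^'p^'n) l *v v = transpose A *v (A *v v) + (real CARD('n) * l) *\<^sub>R v"
  unfolding ridge_gram_def
  by (simp add: matrix_vector_mult_add_rdistrib matrix_vector_mul_assoc
      scaleR_matrix_vector_assoc[symmetric])

lemma ridge_gram_det:
  fixes A :: "real^'p^'n"
  assumes "l > 0" shows "det (ridge_gram A l) \<noteq> 0"
proof -
  have "v = 0" if "ridge_gram A l *v v = 0" for v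
  proof -
    have "0 = v \<bullet> (ridge_gram A l *v v)" using that by simp
    also have "\<dots> = (norm (A *v v))\<^sup>2 + (real CARD('n) * l) * (norm v)\<^sup>2"
      unfolding ridge_gram_vec by (simp only: inner_add_right inner_transpose)
        (simp add: power2_norm_eq_inner)
    finally have "(real CARD('n) * l) * (norm v)\<^sup>2 \<le> 0"
      by (smt (verit) zero_le_power2)
    then have "(norm v)\<^sup>2 \<le> 0"
      using assms by (simp add: mult_le_0_iff)
    then show ?thesis by simp
  qed
  then show ?thesis
    by (metis invertible_det_nz invertible_left_inverse matrix_left_invertible_ker)
qed

lemma ridge_objective_expand:
  fixes A :: "real^'p^'n"
  assumes "ridge_gram A l *v \<beta> = transpose A *v b"
  shows "ridge_objective A b l (\<beta> + d) =
    ridge_objective A b l \<beta> + (norm (A *v d))\<^sup>2 / real CARD('n) + l * (norm d)\<^sup>2"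
proof -
  let ?N = "real CARD('n)"
  have "d \<bullet> (transpose A *v (A *v \<beta>) + (?N * l) *\<^sub>R \<beta>) = d \<bullet> (transpose A *v b)"
    using assms by (simp only: ridge_gram_vec)
  then have "(A *v d) \<bullet> (A *v \<beta>) + ?N * l * (d \<bullet> \<beta>) = (A *v d) \<bullet> b"
    by (simp only: inner_add_right inner_transpose inner_scaleR_right)
  then have 3: "(A *v d) \<bullet> b - (A *v d) \<bullet> (A *v \<beta>) = ?N * (l * (d \<bullet> \<beta>))"
    by (simp add: algebra_simps)
  have 1: "(norm (b - A *v (\<beta> + d)))\<^sup>2 =
      (norm (b - A *v \<beta>))\<^sup>2 + (norm (A *v d))\<^sup>2 - 2 * ((A *v d) \<bullet> b - (A *v d) \<bullet> (A *v \<beta>))"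
    by (simp add: power2_norm_eq_inner matrix_vector_right_distrib inner_diff_left inner_diff_right
        inner_add_left inner_add_right inner_commute)
  have 2: "(norm (\<beta> + d))\<^sup>2 = (norm \<beta>)\<^sup>2 + (norm d)\<^sup>2 + 2 * (d \<bullet> \<beta>)"
    by (simp add: power2_norm_eq_inner inner_add_left inner_add_right inner_commute)
  show ?thesis unfolding ridge_objective_def 1 2 3
    by (simp add: field_simps)
qed

lemma ridge_normal_equation:
  fixes A :: "real^'p^'n"
  assumes "l > 0"
  shows "ridge_gram A l *v ridge A b l = transpose A *v b"
proof -
  obtain \<beta> where \<beta>: "ridge_gram A l *v \<beta> = transpose A *v b"
    using cramer[OF ridge_gram_det[OF assms]] by blast
  have less: "ridge_objective A b l \<beta> < ridge_objective A b l \<gamma>" if "\<gamma> \<noteq> \<beta>" for \<gamma>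
  proof -
    have "0 \<le> (norm (A *v (\<gamma> - \<beta>)))\<^sup>2 / real CARD('n)" "0 < l * (norm (\<gamma> - \<beta>))\<^sup>2"
      using that assms by simp_all
    then show ?thesis
      using ridge_objective_expand[OF \<beta>, of "\<gamma> - \<beta>"] by (simp, linarith)
  qed
  have "ridge A b l = \<beta>"
    unfolding ridge_def arg_min_def is_arg_min_def
    using less by (intro some_equality) (auto, metis less_asym)
  then show ?thesis using \<beta> by simp
qed

lemma continuous_on_ridge [continuous_intros]:
  fixes A :: "'z::topological_space \<Rightarrow> real^'p^'n"
  assumes l: "l > 0" and A: "continuous_on S A" and b: "continuous_on S b"
  shows "continuous_on S (\<lambda>z. ridge (A z) (b z) l)"
proof -
  have eq: "ridge (A z) (b z) l =
      (\<chi> k. det (\<chi> i j. if j = k then (transpose (A z) *v b z) $ i else ridge_gram (A z) l $ i $ j)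
             / det (ridge_gram (A z) l))" for z
    using cramer[OF ridge_gram_det[OF l]] ridge_normal_equation[OF l] by blast
  have c1: "continuous_on S (\<lambda>z. (transpose (A z) *v b z) $ i)" for i
    by (simp add: matrix_vector_mult_def transpose_def del: transpose_matrix_vector)
       (intro continuous_intros A b)
  have c2: "continuous_on S (\<lambda>z. ridge_gram (A z) l $ i $ j)" for i j
    by (cases "i = j") (auto simp: ridge_gram_def matrix_matrix_mult_def transpose_def mat_def
        intro!: continuous_intros A)
  have c3: "continuous_on S (\<lambda>z. (if j = k then (transpose (A z) *v b z) $ i
      else ridge_gram (A z) l $ i $ j))" for i j k
    using c1 c2 by (cases "j = k") auto
  have c4: "continuous_on S (\<lambda>z. det (ridge_gram (A z) l))"
    unfolding det_def by (intro continuous_intros c2)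
  have c5: "continuous_on S (\<lambda>z. det (\<chi> i j. if j = k then (transpose (A z) *v b z) $ i
      else ridge_gram (A z) l $ i $ j))" for k
    unfolding det_def vec_lambda_beta by (intro continuous_intros c3)
  show ?thesis
    unfolding eq
    by (intro continuous_on_vec_lambda continuous_on_divide c4 c5 ballI ridge_gram_det[OF l])
qed

lemma continuous_on_students:
  fixes g :: "'z::topological_space \<Rightarrow> (real^'p^'n) \<times> (real^'n) \<times> (real^'p^'m)"
  assumes lt: "lt > 0" and ls: "ls > 0"
  shows "continuous_on UNIV (\<lambda>((X::real^'p^'n, y, Xu::real^'p^'m), (x, v::real)). teacher lt X y x)"
    and "continuous_on UNIV (\<lambda>((X::real^'p^'n, y, Xu::real^'p^'m), (x, v::real)). pd_student lt ls X y Xu x)"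
  unfolding teacher_def pd_student_def pseudo_labels_def case_prod_beta
  by (intro continuous_intros lt ls)+


section \<open>Conditional expectations given the data, with an independent test point\<close>

context prob_space
begin

lemma subalgebra_vimage:
  assumes "D \<in> borel_measurable M"
  shows "subalgebra M (vimage_algebra (space M) D borel)"
  using assms unfolding subalgebra_def
  by (auto simp: sets_vimage_algebra2 measurable_sets)

lemma nn_cond_exp_freeze:
  fixes D :: "'a \<Rightarrow> 'd::second_countable_topology" and Z :: "'a \<Rightarrow> 'z::second_countable_topology"
    and h :: "'d \<times> 'z \<Rightarrow> ennreal"
  assumes D [measurable]: "D \<in> borel_measurable M" and Z [measurable]: "Z \<in> borel_measurable M"
    and ind: "indep_set (sets (vimage_algebra (space M) D borel))
                        (sets (vimage_algebra (space M) Z borel))"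
    and h [measurable]: "h \<in> borel_measurable borel"
  shows "AE \<omega> in M. nn_cond_exp M (vimage_algebra (space M) D borel) (\<lambda>\<omega>. h (D \<omega>, Z \<omega>)) \<omega>
            = (\<integral>\<^sup>+\<omega>'. h (D \<omega>, Z \<omega>') \<partial>M)"
proof -
  let ?F = "vimage_algebra (space M) D borel"
  interpret F: finite_measure_subalgebra M ?F
    by standard (rule subalgebra_vimage[OF D])
  have h' [measurable]: "h \<in> borel_measurable (borel \<Otimes>\<^sub>M borel)"
    using h by (simp add: borel_prod)
  interpret DD: prob_space "distr M borel D" by (rule prob_space_distr) simp
  interpret DZ: prob_space "distr M borel Z" by (rule prob_space_distr) simp
  have prod: "distr M borel D \<Otimes>\<^sub>M distr M borel Z = distr M (borel \<Otimes>\<^sub>M borel) (\<lambda>\<omega>. (D \<omega>, Z \<omega>))"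
  proof (rule pair_measure_eqI)
    show "sigma_finite_measure (distr M borel D)" "sigma_finite_measure (distr M borel Z)"
      by unfold_locales
    show "sets (distr M borel D \<Otimes>\<^sub>M distr M borel Z) =
        sets (distr M (borel \<Otimes>\<^sub>M borel) (\<lambda>\<omega>. (D \<omega>, Z \<omega>)))"
      by (simp cong: sets_pair_measure_cong)
    fix A B assume "A \<in> sets (distr M borel D)" "B \<in> sets (distr M borel Z)"
    then have [measurable]: "A \<in> sets borel" "B \<in> sets borel" by simp_all
    have "prob ((D -` A \<inter> space M) \<inter> (Z -` B \<inter> space M)) =
        prob (D -` A \<inter> space M) * prob (Z -` B \<inter> space M)"
      by (rule indep_setD[OF ind]) (auto simp: sets_vimage_algebra2)
    moreover have "(\<lambda>\<omega>. (D \<omega>, Z \<omega>)) -` (A \<times> B) \<inter> space M =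
        (D -` A \<inter> space M) \<inter> (Z -` B \<inter> space M)" by auto
    ultimately show "emeasure (distr M borel D) A * emeasure (distr M borel Z) B =
        emeasure (distr M (borel \<Otimes>\<^sub>M borel) (\<lambda>\<omega>. (D \<omega>, Z \<omega>))) (A \<times> B)"
      by (simp add: emeasure_distr emeasure_eq_measure ennreal_mult[symmetric])
  qed
  define g where "g d = (\<integral>\<^sup>+z. h (d, z) \<partial>distr M borel Z)" for d
  have g_eq: "g d = (\<integral>\<^sup>+\<omega>'. h (d, Z \<omega>') \<partial>M)" for d
    unfolding g_def by (subst nn_integral_distr) auto
  have [measurable]: "g \<in> borel_measurable borel"
    unfolding g_def by measurable
  have "AE \<omega> in M. g (D \<omega>) = nn_cond_exp M ?F (\<lambda>\<omega>. h (D \<omega>, Z \<omega>)) \<omega>"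
  proof (rule F.nn_cond_exp_charact)
    show "(\<lambda>\<omega>. g (D \<omega>)) \<in> borel_measurable ?F"
      by (rule measurable_compose[OF measurable_vimage_algebra1]) auto
    show "(\<lambda>\<omega>. h (D \<omega>, Z \<omega>)) \<in> borel_measurable M" by measurable
    fix A assume "A \<in> sets ?F"
    then obtain B where [measurable]: "B \<in> sets borel" and A: "A = D -` B \<inter> space M"
      by (auto simp: sets_vimage_algebra2)
    have "(\<integral>\<^sup>+\<omega>\<in>A. h (D \<omega>, Z \<omega>) \<partial>M) = (\<integral>\<^sup>+\<omega>. h (D \<omega>, Z \<omega>) * indicator B (D \<omega>) \<partial>M)"
      by (intro nn_integral_cong) (auto simp: A indicator_def)
    also have "\<dots> = (\<integral>\<^sup>+p. h p * indicator B (fst p)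
        \<partial>distr M (borel \<Otimes>\<^sub>M borel) (\<lambda>\<omega>. (D \<omega>, Z \<omega>)))"
      by (subst nn_integral_distr) auto
    also have "\<dots> = (\<integral>\<^sup>+d. \<integral>\<^sup>+z. h (d, z) * indicator B d \<partial>distr M borel Z \<partial>distr M borel D)"
      unfolding prod[symmetric] by (subst DZ.nn_integral_fst[symmetric]) auto
    also have "\<dots> = (\<integral>\<^sup>+d. g d * indicator B d \<partial>distr M borel D)"
      unfolding g_def by (simp add: nn_integral_multc)
    also have "\<dots> = (\<integral>\<^sup>+\<omega>. g (D \<omega>) * indicator B (D \<omega>) \<partial>M)"
      by (subst nn_integral_distr) auto
    also have "\<dots> = (\<integral>\<^sup>+\<omega>\<in>A. g (D \<omega>) \<partial>M)"
      by (intro nn_integral_cong) (auto simp: A indicator_def)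
    finally show "(\<integral>\<^sup>+\<omega>\<in>A. h (D \<omega>, Z \<omega>) \<partial>M) = (\<integral>\<^sup>+\<omega>\<in>A. g (D \<omega>) \<partial>M)" .
  qed
  then show ?thesis by (auto simp: g_eq)
qed

lemma real_cond_exp_freeze:
  fixes D :: "'a \<Rightarrow> 'd::second_countable_topology" and Z :: "'a \<Rightarrow> 'z::second_countable_topology"
    and h :: "'d \<times> 'z \<Rightarrow> real"
  assumes "D \<in> borel_measurable M" "Z \<in> borel_measurable M"
    and "indep_set (sets (vimage_algebra (space M) D borel))
                   (sets (vimage_algebra (space M) Z borel))"
    and [measurable]: "h \<in> borel_measurable borel"
  shows "AE \<omega> in M. integrable M (\<lambda>\<omega>'. h (D \<omega>, Z \<omega>')) \<longrightarrow>
      real_cond_exp M (vimage_algebra (space M) D borel) (\<lambda>\<omega>. h (D \<omega>, Z \<omega>)) \<omega>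
        = (\<integral>\<omega>'. h (D \<omega>, Z \<omega>') \<partial>M)"
proof -
  have "(\<lambda>p. ennreal (h p)) \<in> borel_measurable borel" "(\<lambda>p. ennreal (- h p)) \<in> borel_measurable borel"
    by measurable
  from this[THEN nn_cond_exp_freeze[OF assms(1-3)]] show ?thesis
    by eventually_elim (auto simp: real_cond_exp_def real_lebesgue_integral_def)
qed

end


section \<open>A continuous version of the mixed risk exists\<close>

lemma (in distillation_model) continuous_cond_risk_version_exists:
  fixes lt ls :: real
  defines "F \<equiv> data_algebra M X y Xu"
    and "f \<equiv> \<lambda>\<omega>. teacher lt (X \<omega>) (y \<omega>)"
    and "fpd \<equiv> \<lambda>\<omega>. pd_student lt ls (X \<omega>) (y \<omega>) (Xu \<omega>)"
    and "fpmsd \<equiv> \<lambda>\<xi> \<omega>. pmsd_student lt ls \<xi> (X \<omega>) (y \<omega>) (Xu \<omega>)"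
  assumes lt: "lt > 0" and ls: "ls > 0"
    and fin: "finite_cond_risk M F x0 y0 f" "finite_cond_risk M F x0 y0 fpd"
  shows "continuous_cond_risk_version M F x0 y0 fpmsd
           (\<lambda>\<xi> \<omega>. \<integral>\<omega>'. (y0 \<omega>' - fpmsd \<xi> \<omega> (x0 \<omega>'))\<^sup>2 \<partial>M)"
proof -
  let ?D = "\<lambda>\<omega>. (X \<omega>, y \<omega>, Xu \<omega>)" and ?Z = "\<lambda>\<omega>. (x0 \<omega>, y0 \<omega>)"
  define t :: "((real^'p^'n) \<times> (real^'n) \<times> (real^'p^'m)) \<times> (real^'p) \<times> real \<Rightarrow> real"
    where "t = (\<lambda>((X, y, Xu), (x, v)). v - teacher lt X y x)"
  define s :: "((real^'p^'n) \<times> (real^'n) \<times> (real^'p^'m)) \<times> (real^'p) \<times> real \<Rightarrow> real"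
    where "s = (\<lambda>((X, y, Xu), (x, v)). v - pd_student lt ls X y Xu x)"
  have [measurable]: "t \<in> borel_measurable borel" "s \<in> borel_measurable borel"
    unfolding t_def s_def case_prod_beta
    by (intro borel_measurable_continuous_onI continuous_intros
        continuous_on_students[OF lt ls, unfolded case_prod_beta])+
  have DZ [measurable]: "?D \<in> borel_measurable M" "?Z \<in> borel_measurable M"
    by measurable
  note ind = test_indep[unfolded data_algebra_def]
  note nn = nn_cond_exp_freeze[OF DZ ind] and re = real_cond_exp_freeze[OF DZ ind]
  have td: "y0 \<omega>' - f \<omega> (x0 \<omega>') = t (?D \<omega>, ?Z \<omega>')" for \<omega> \<omega>' by (simp add: t_def f_def)
  have sd: "y0 \<omega>' - fpd \<omega> (x0 \<omega>') = s (?D \<omega>, ?Z \<omega>')" for \<omega> \<omega>' by (simp add: s_def fpd_def)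
  have md: "y0 \<omega>' - fpmsd \<xi> \<omega> (x0 \<omega>') = (1 - \<xi>) * t (?D \<omega>, ?Z \<omega>') + \<xi> * s (?D \<omega>, ?Z \<omega>')"
    for \<xi> \<omega> \<omega>' by (simp add: t_def s_def fpmsd_def pmsd_student_def algebra_simps)
  have F: "F = vimage_algebra (space M) ?D borel" by (simp add: F_def data_algebra_def)
  have m: "(\<lambda>p. ennreal ((t p)\<^sup>2)) \<in> borel_measurable borel"
      "(\<lambda>p. ennreal ((s p)\<^sup>2)) \<in> borel_measurable borel"
      "(\<lambda>p. ((1 - \<xi>) * t p + \<xi> * s p)\<^sup>2) \<in> borel_measurable borel" for \<xi>
    by measurable
  have "AE \<omega> in M. (\<integral>\<^sup>+\<omega>'. ennreal ((t (?D \<omega>, ?Z \<omega>'))\<^sup>2) \<partial>M) < \<infinity>"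
    using fin(1)[unfolded finite_cond_risk_def td F] nn[OF m(1)]
    by eventually_elim auto
  moreover have "AE \<omega> in M. (\<integral>\<^sup>+\<omega>'. ennreal ((s (?D \<omega>, ?Z \<omega>'))\<^sup>2) \<partial>M) < \<infinity>"
    using fin(2)[unfolded finite_cond_risk_def sd F] nn[OF m(2)]
    by eventually_elim auto
  ultimately have int: "AE \<omega> in M. integrable M (\<lambda>\<omega>'. (t (?D \<omega>, ?Z \<omega>'))\<^sup>2) \<and>
      integrable M (\<lambda>\<omega>'. (s (?D \<omega>, ?Z \<omega>'))\<^sup>2)"
    by eventually_elim (intro conjI integrableI_bounded, auto)
  have bil: "integrable M (\<lambda>\<omega>'. t (?D \<omega>, ?Z \<omega>') * s (?D \<omega>, ?Z \<omega>'))"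
    if "integrable M (\<lambda>\<omega>'. (t (?D \<omega>, ?Z \<omega>'))\<^sup>2)" "integrable M (\<lambda>\<omega>'. (s (?D \<omega>, ?Z \<omega>'))\<^sup>2)" for \<omega>
  proof (rule Bochner_Integration.integrable_bound[OF Bochner_Integration.integrable_add[OF that]])
    show "AE \<omega>' in M. norm (t (?D \<omega>, ?Z \<omega>') * s (?D \<omega>, ?Z \<omega>'))
        \<le> norm ((t (?D \<omega>, ?Z \<omega>'))\<^sup>2 + (s (?D \<omega>, ?Z \<omega>'))\<^sup>2)"
    proof (rule AE_I2)
      fix \<omega>' 
      have "2 * (\<bar>a\<bar> * \<bar>b\<bar>) \<le> a\<^sup>2 + b\<^sup>2" for a b :: real
        using zero_le_power2[of "\<bar>a\<bar> - \<bar>b\<bar>"] by (simp add: power2_diff)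
      moreover have "0 \<le> \<bar>a\<bar> * \<bar>b\<bar>" for a b :: real by simp
      ultimately have "\<bar>a\<bar> * \<bar>b\<bar> \<le> a\<^sup>2 + b\<^sup>2" for a b :: real by (smt (verit))
      then show "norm (t (?D \<omega>, ?Z \<omega>') * s (?D \<omega>, ?Z \<omega>'))
        \<le> norm ((t (?D \<omega>, ?Z \<omega>'))\<^sup>2 + (s (?D \<omega>, ?Z \<omega>'))\<^sup>2)" by (simp add: abs_mult)
    qed
  qed measurable
  have sq: "((1 - \<xi>) * a + \<xi> * b)\<^sup>2 = (1 - \<xi>)\<^sup>2 * a\<^sup>2 + \<xi>\<^sup>2 * b\<^sup>2 + (2 * \<xi> * (1 - \<xi>)) * (a * b)"
    for a b \<xi> :: real by (simp add: power2_eq_square algebra_simps)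
  have "AE \<omega> in M. continuous_on UNIV (\<lambda>\<xi>. \<integral>\<omega>'. (y0 \<omega>' - fpmsd \<xi> \<omega> (x0 \<omega>'))\<^sup>2 \<partial>M)"
    using int unfolding md sq
  proof eventually_elim
    case (elim \<omega>)
    note i = conjunct1[OF elim] conjunct2[OF elim] bil[OF conjunct1[OF elim] conjunct2[OF elim]]
    show ?case
      by (simp add: i del: integral_mult_right_zero) (intro continuous_intros)
  qed
  moreover have "AE \<omega> in M. (\<integral>\<omega>'. (y0 \<omega>' - fpmsd \<xi> \<omega> (x0 \<omega>'))\<^sup>2 \<partial>M)
      = cond_risk M F x0 y0 (fpmsd \<xi>) \<omega>" for \<xi>
    using int re[OF m(3), of \<xi>]
    unfolding cond_risk_def md F sq
    by eventually_elim (simp add: bil)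
  ultimately show ?thesis
    unfolding continuous_cond_risk_version_def by blast
qed

end

theory Submission
  imports Defs
begin

text \<open>
  Write \<open>t\<close> and \<open>s\<close> for the test errors of the teacher and of the pure-distilled student. The test
  error of the mixture is \<open>(1 - \<xi>) t + \<xi> s\<close>, so once conditional expectation may be treated as
  linear, the mixed risk is the quadratic \<open>(1 - \<xi>)\<^sup>2 R + 2 \<xi> (1 - \<xi>) C + \<xi>\<^sup>2 Rpd\<close> with leading
  coefficient \<open>D\<close>, and completing the square (\<open>mixed_risk_complete_square\<close>) gives minimiser and
  minimum.

  There are two measure-theoretic points. The squared errors have finite conditional, but not
  necessarily finite unconditional, expectation, so linearity of conditional expectation for
  integrable functions is not enough. Instead, the independence of the test point from the data
  turns conditional expectations into integrals over the test point with the data held fixed, where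
  the squared errors are integrable for almost every data set (\<open>cond_exp_mixture_square\<close>).
  This identifies the mixed risk with the quadratic almost surely for each single \<open>\<xi>\<close>; a
  common null set for all \<open>\<xi>\<close> is obtained by using rational \<open>\<xi>\<close> only and then continuity in \<open>\<xi>\<close>
  (\<open>AE_eq_continuous_families\<close>).
\<close>

section \<open>The quadratic in the mixing weight\<close>

text \<open>The constant term is the value at the minimiser. Its two forms agree because
  \<open>(a - c)\<^sup>2 - (b - c)\<^sup>2 = (a - b) (a + b - 2 c)\<close>.\<close>

lemma mixed_risk_complete_square:
  fixes a b c \<xi> :: real
  defines "d \<equiv> a + b - 2 * c"
  assumes "d \<noteq> 0"
  shows "(1 - \<xi>)\<^sup>2 * a + 2 * \<xi> * (1 - \<xi>) * c + \<xi>\<^sup>2 * b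
      = a - (a - c)\<^sup>2 / d + d * (\<xi> - (a - c) / d)\<^sup>2"
    and "a - (a - c)\<^sup>2 / d = b - (b - c)\<^sup>2 / d"
proof -
  have "d * (\<xi> - (a - c) / d)\<^sup>2 = d * \<xi>\<^sup>2 - 2 * \<xi> * (a - c) + (a - c)\<^sup>2 / d"
    using \<open>d \<noteq> 0\<close> by (simp add: power2_eq_square field_simps)
  then show "(1 - \<xi>)\<^sup>2 * a + 2 * \<xi> * (1 - \<xi>) * c + \<xi>\<^sup>2 * b
      = a - (a - c)\<^sup>2 / d + d * (\<xi> - (a - c) / d)\<^sup>2"
    by (simp add: d_def power2_eq_square algebra_simps)
  have "(a - c)\<^sup>2 - (b - c)\<^sup>2 = (a - b) * d"
    by (simp add: d_def power2_eq_square algebra_simps)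
  then have "(a - c)\<^sup>2 / d - (b - c)\<^sup>2 / d = a - b"
    using \<open>d \<noteq> 0\<close> by (simp add: diff_divide_distrib[symmetric])
  then show "a - (a - c)\<^sup>2 / d = b - (b - c)\<^sup>2 / d" by simp
qed

lemma is_arg_min_square:
  fixes d m z :: real
  assumes "d > 0"
  shows "is_arg_min (\<lambda>x. m + d * (x - z)\<^sup>2) (\<lambda>_. True) x \<longleftrightarrow> x = z"
proof
  assume "is_arg_min (\<lambda>x. m + d * (x - z)\<^sup>2) (\<lambda>_. True) x"
  then have "\<not> (m + d * (z - z)\<^sup>2 < m + d * (x - z)\<^sup>2)"
    unfolding is_arg_min_def by blast
  then show "x = z" using assms by (auto simp: zero_less_mult_iff)
next
  assume "x = z"
  then show "is_arg_min (\<lambda>x. m + d * (x - z)\<^sup>2) (\<lambda>_. True) x"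
    using assms by (auto simp: is_arg_min_def not_less)
qed


section \<open>One null set for all parameters\<close>

text \<open>Two continuous functions of a real parameter that agree at all rationals are equal, and only
  countably many null sets have to be discarded for agreement at all rationals.\<close>

lemma AE_eq_continuous_families:
  fixes V W :: "real \<Rightarrow> 'a \<Rightarrow> real"
  assumes eq: "\<And>\<xi>. AE \<omega> in M. V \<xi> \<omega> = W \<xi> \<omega>"
    and V: "AE \<omega> in M. continuous_on UNIV (\<lambda>\<xi>. V \<xi> \<omega>)"
    and W: "AE \<omega> in M. continuous_on UNIV (\<lambda>\<xi>. W \<xi> \<omega>)"
  shows "AE \<omega> in M. \<forall>\<xi>. V \<xi> \<omega> = W \<xi> \<omega>"
proof -
  have "AE \<omega> in M. \<forall>\<xi>\<in>\<rat>. V \<xi> \<omega> = W \<xi> \<omega>"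
    using eq by (simp add: AE_ball_countable[OF countable_rat])
  with V W show ?thesis
  proof eventually_elim
    case (elim \<omega>)
    have cl: "closure (\<rat> :: real set) = UNIV" by (rule Rats_closure_real)
    have "V \<xi> \<omega> - W \<xi> \<omega> = 0" for \<xi>
    proof (rule continuous_constant_on_closure[where S = \<rat> and f = "\<lambda>\<xi>. V \<xi> \<omega> - W \<xi> \<omega>"])
      show "continuous_on (closure \<rat>) (\<lambda>\<xi>. V \<xi> \<omega> - W \<xi> \<omega>)"
        unfolding cl by (intro continuous_on_diff elim)
      show "\<xi> \<in> closure \<rat>" by (simp add: cl)
    qed (use elim in auto)
    then show ?case by simp
  qed
qed


section \<open>Conditional second moments of a mixture\<close>

lemma integrable_mult_of_squares:
  fixes t s :: "'a \<Rightarrow> real"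
  assumes [measurable]: "t \<in> borel_measurable M" "s \<in> borel_measurable M"
    and "integrable M (\<lambda>x. (t x)\<^sup>2)" "integrable M (\<lambda>x. (s x)\<^sup>2)"
  shows "integrable M (\<lambda>x. t x * s x)"
proof (rule Bochner_Integration.integrable_bound)
  show "integrable M (\<lambda>x. (t x)\<^sup>2 + (s x)\<^sup>2)"
    using assms(3,4) by (rule Bochner_Integration.integrable_add)
  have "\<bar>a * b\<bar> \<le> a\<^sup>2 + b\<^sup>2" for a b :: real
    using zero_le_power2[of "\<bar>a\<bar> - \<bar>b\<bar>"] mult_nonneg_nonneg[of "\<bar>a\<bar>" "\<bar>b\<bar>"]
    unfolding power2_diff power2_abs abs_mult by linarith
  then show "AE x in M. norm (t x * s x) \<le> norm ((t x)\<^sup>2 + (s x)\<^sup>2)" by simp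
qed measurable

text \<open>The integrability of \<open>t\<close> and \<open>s\<close> is assumed given the data \<open>D\<close> only, so the expansion of
  the square is carried out below the conditional expectation, for fixed data: there
  \<^const>\<open>real_cond_exp\<close> is an honest integral over the independent variable \<open>Z\<close>.\<close>

lemma (in prob_space) cond_exp_mixture_square:
  fixes D :: "'a \<Rightarrow> 'd::second_countable_topology" and Z :: "'a \<Rightarrow> 'z::second_countable_topology"
    and t s :: "'d \<times> 'z \<Rightarrow> real" and \<xi> :: real
  defines "F \<equiv> vimage_algebra (space M) D borel"
  assumes D [measurable]: "D \<in> borel_measurable M" and Z [measurable]: "Z \<in> borel_measurable M"
    and ind: "indep_set (sets F) (sets (vimage_algebra (space M) Z borel))"
    and t [measurable]: "t \<in> borel_measurable borel" and s [measurable]: "s \<in> borel_measurable borel"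
    and fin_t: "AE \<omega> in M. nn_cond_exp M F (\<lambda>\<omega>. ennreal ((t (D \<omega>, Z \<omega>))\<^sup>2)) \<omega> < \<infinity>"
    and fin_s: "AE \<omega> in M. nn_cond_exp M F (\<lambda>\<omega>. ennreal ((s (D \<omega>, Z \<omega>))\<^sup>2)) \<omega> < \<infinity>"
  shows "AE \<omega> in M. real_cond_exp M F (\<lambda>\<omega>. ((1 - \<xi>) * t (D \<omega>, Z \<omega>) + \<xi> * s (D \<omega>, Z \<omega>))\<^sup>2) \<omega>
      = (1 - \<xi>)\<^sup>2 * real_cond_exp M F (\<lambda>\<omega>. (t (D \<omega>, Z \<omega>))\<^sup>2) \<omega>
        + 2 * \<xi> * (1 - \<xi>) * real_cond_exp M F (\<lambda>\<omega>. t (D \<omega>, Z \<omega>) * s (D \<omega>, Z \<omega>)) \<omega>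
        + \<xi>\<^sup>2 * real_cond_exp M F (\<lambda>\<omega>. (s (D \<omega>, Z \<omega>))\<^sup>2) \<omega>"
proof -
  note nn = nn_cond_exp_freeze[OF D Z ind[unfolded F_def], folded F_def]
  note re = real_cond_exp_freeze[OF D Z ind[unfolded F_def], folded F_def]
  have nn_t: "AE \<omega> in M. nn_cond_exp M F (\<lambda>\<omega>. ennreal ((t (D \<omega>, Z \<omega>))\<^sup>2)) \<omega>
      = (\<integral>\<^sup>+\<omega>'. ennreal ((t (D \<omega>, Z \<omega>'))\<^sup>2) \<partial>M)"
    by (rule nn[where h = "\<lambda>p. ennreal ((t p)\<^sup>2)"]) measurable
  have nn_s: "AE \<omega> in M. nn_cond_exp M F (\<lambda>\<omega>. ennreal ((s (D \<omega>, Z \<omega>))\<^sup>2)) \<omega>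
      = (\<integral>\<^sup>+\<omega>'. ennreal ((s (D \<omega>, Z \<omega>'))\<^sup>2) \<partial>M)"
    by (rule nn[where h = "\<lambda>p. ennreal ((s p)\<^sup>2)"]) measurable
  have re_tt: "AE \<omega> in M. integrable M (\<lambda>\<omega>'. (t (D \<omega>, Z \<omega>'))\<^sup>2) \<longrightarrow>
      real_cond_exp M F (\<lambda>\<omega>. (t (D \<omega>, Z \<omega>))\<^sup>2) \<omega> = (\<integral>\<omega>'. (t (D \<omega>, Z \<omega>'))\<^sup>2 \<partial>M)"
    by (rule re[where h = "\<lambda>p. (t p)\<^sup>2"]) measurable
  have re_ss: "AE \<omega> in M. integrable M (\<lambda>\<omega>'. (s (D \<omega>, Z \<omega>'))\<^sup>2) \<longrightarrow>
      real_cond_exp M F (\<lambda>\<omega>. (s (D \<omega>, Z \<omega>))\<^sup>2) \<omega> = (\<integral>\<omega>'. (s (D \<omega>, Z \<omega>'))\<^sup>2 \<partial>M)"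
    by (rule re[where h = "\<lambda>p. (s p)\<^sup>2"]) measurable
  have re_ts: "AE \<omega> in M. integrable M (\<lambda>\<omega>'. t (D \<omega>, Z \<omega>') * s (D \<omega>, Z \<omega>')) \<longrightarrow>
      real_cond_exp M F (\<lambda>\<omega>. t (D \<omega>, Z \<omega>) * s (D \<omega>, Z \<omega>)) \<omega>
        = (\<integral>\<omega>'. t (D \<omega>, Z \<omega>') * s (D \<omega>, Z \<omega>') \<partial>M)"
    by (rule re[where h = "\<lambda>p. t p * s p"]) measurable
  have re_mix: "AE \<omega> in M.
      integrable M (\<lambda>\<omega>'. ((1 - \<xi>) * t (D \<omega>, Z \<omega>') + \<xi> * s (D \<omega>, Z \<omega>'))\<^sup>2) \<longrightarrow>
      real_cond_exp M F (\<lambda>\<omega>. ((1 - \<xi>) * t (D \<omega>, Z \<omega>) + \<xi> * s (D \<omega>, Z \<omega>))\<^sup>2) \<omega>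
        = (\<integral>\<omega>'. ((1 - \<xi>) * t (D \<omega>, Z \<omega>') + \<xi> * s (D \<omega>, Z \<omega>'))\<^sup>2 \<partial>M)"
    by (rule re[where h = "\<lambda>p. ((1 - \<xi>) * t p + \<xi> * s p)\<^sup>2"]) measurable
  have expand: "((1 - \<xi>) * a + \<xi> * b)\<^sup>2
      = (1 - \<xi>)\<^sup>2 * a\<^sup>2 + 2 * \<xi> * (1 - \<xi>) * (a * b) + \<xi>\<^sup>2 * b\<^sup>2" for a b :: real
    by (simp add: power2_eq_square algebra_simps)
  show ?thesis
    using fin_t fin_s nn_t nn_s re_tt re_ss re_ts re_mix
  proof eventually_elim
    case (elim \<omega>)
    have tt: "integrable M (\<lambda>\<omega>'. (t (D \<omega>, Z \<omega>'))\<^sup>2)"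
      using elim(1,3) by (intro integrableI_bounded) auto
    have ss: "integrable M (\<lambda>\<omega>'. (s (D \<omega>, Z \<omega>'))\<^sup>2)"
      using elim(2,4) by (intro integrableI_bounded) auto
    have ts: "integrable M (\<lambda>\<omega>'. t (D \<omega>, Z \<omega>') * s (D \<omega>, Z \<omega>'))"
      by (rule integrable_mult_of_squares[OF _ _ tt ss]) measurable
    have mix: "integrable M (\<lambda>\<omega>'. ((1 - \<xi>) * t (D \<omega>, Z \<omega>') + \<xi> * s (D \<omega>, Z \<omega>'))\<^sup>2)"
      unfolding expand by (intro Bochner_Integration.integrable_add integrable_mult_right tt ts ss)
    have "(\<integral>\<omega>'. ((1 - \<xi>) * t (D \<omega>, Z \<omega>') + \<xi> * s (D \<omega>, Z \<omega>'))\<^sup>2 \<partial>M)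
        = (1 - \<xi>)\<^sup>2 * (\<integral>\<omega>'. (t (D \<omega>, Z \<omega>'))\<^sup>2 \<partial>M)
          + 2 * \<xi> * (1 - \<xi>) * (\<integral>\<omega>'. t (D \<omega>, Z \<omega>') * s (D \<omega>, Z \<omega>') \<partial>M)
          + \<xi>\<^sup>2 * (\<integral>\<omega>'. (s (D \<omega>, Z \<omega>'))\<^sup>2 \<partial>M)"
      unfolding expand
      by (simp only: Bochner_Integration.integral_add Bochner_Integration.integrable_add
          integrable_mult_right integral_mult_right_zero tt ts ss)
    then show ?case
      by (simp only: elim(5)[rule_format, OF tt] elim(6)[rule_format, OF ss]
          elim(7)[rule_format, OF ts] elim(8)[rule_format, OF mix])
  qed
qed


section \<open>The optimal mixing weight\<close>

text \<open>Both test errors are fixed measurable functions of the pair of data and test point,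
  because the ridge estimator is continuous in the data for a positive penalty. The mixture is
  affine in \<open>\<xi>\<close> as its weights sum to one, so the response enters it with weight one.\<close>

lemma (in distillation_model) cond_risk_pmsd_quadratic:
  fixes lt ls \<xi> :: real
  defines "F \<equiv> data_algebra M X y Xu"
    and "f \<equiv> \<lambda>\<omega>. teacher lt (X \<omega>) (y \<omega>)"
    and "fpd \<equiv> \<lambda>\<omega>. pd_student lt ls (X \<omega>) (y \<omega>) (Xu \<omega>)"
    and "fpmsd \<equiv> \<lambda>\<xi> \<omega>. pmsd_student lt ls \<xi> (X \<omega>) (y \<omega>) (Xu \<omega>)"
  assumes lt: "lt > 0" and ls: "ls > 0"
    and fin: "finite_cond_risk M F x0 y0 f" "finite_cond_risk M F x0 y0 fpd"
  shows "AE \<omega> in M. cond_risk M F x0 y0 (fpmsd \<xi>) \<omega>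
      = (1 - \<xi>)\<^sup>2 * cond_risk M F x0 y0 f \<omega>
        + 2 * \<xi> * (1 - \<xi>) * cond_cross_risk M F x0 y0 f fpd \<omega>
        + \<xi>\<^sup>2 * cond_risk M F x0 y0 fpd \<omega>"
proof -
  let ?D = "\<lambda>\<omega>. (X \<omega>, y \<omega>, Xu \<omega>)" and ?Z = "\<lambda>\<omega>. (x0 \<omega>, y0 \<omega>)"
  define t :: "((real^'p^'n) \<times> (real^'n) \<times> (real^'p^'m)) \<times> (real^'p) \<times> real \<Rightarrow> real"
    where "t = (\<lambda>((X, y, Xu), (x, v)). v - teacher lt X y x)"
  define s :: "((real^'p^'n) \<times> (real^'n) \<times> (real^'p^'m)) \<times> (real^'p) \<times> real \<Rightarrow> real"
    where "s = (\<lambda>((X, y, Xu), (x, v)). v - pd_student lt ls X y Xu x)"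
  have ts: "t \<in> borel_measurable borel" "s \<in> borel_measurable borel"
    unfolding t_def s_def case_prod_beta
    by (intro borel_measurable_continuous_onI continuous_intros
        continuous_on_students[OF lt ls, unfolded case_prod_beta])+
  have DZ: "?D \<in> borel_measurable M" "?Z \<in> borel_measurable M"
    by measurable
  have F: "F = vimage_algebra (space M) ?D borel" by (simp add: F_def data_algebra_def)
  have td: "y0 \<omega> - f \<omega> (x0 \<omega>) = t (?D \<omega>, ?Z \<omega>)" for \<omega> by (simp add: t_def f_def)
  have sd: "y0 \<omega> - fpd \<omega> (x0 \<omega>) = s (?D \<omega>, ?Z \<omega>)" for \<omega> by (simp add: s_def fpd_def)
  have md: "y0 \<omega> - fpmsd \<xi> \<omega> (x0 \<omega>) = (1 - \<xi>) * t (?D \<omega>, ?Z \<omega>) + \<xi> * s (?D \<omega>, ?Z \<omega>)" for \<omega>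
    by (simp add: t_def s_def fpmsd_def pmsd_student_def algebra_simps)
  show ?thesis
    unfolding cond_risk_def cond_cross_risk_def md td sd F
    by (rule cond_exp_mixture_square[OF DZ test_indep[unfolded data_algebra_def] ts
          fin[unfolded finite_cond_risk_def td sd F]])
qed

theorem mainTheorem1:
  fixes M :: "'w measure"
    and X :: "'w \<Rightarrow> real^'p^'n" and y :: "'w \<Rightarrow> real^'n" and Xu :: "'w \<Rightarrow> real^'p^'m"
    and x0 :: "'w \<Rightarrow> real^'p" and y0 :: "'w \<Rightarrow> real"
    and lt ls :: real
    and R Rpd C D :: "'w \<Rightarrow> real" and Rpmsd :: "real \<Rightarrow> 'w \<Rightarrow> real"
  defines "F \<equiv> data_algebra M X y Xu"
    and "f \<equiv> \<lambda>\<omega>. teacher lt (X \<omega>) (y \<omega>)"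
    and "fpd \<equiv> \<lambda>\<omega>. pd_student lt ls (X \<omega>) (y \<omega>) (Xu \<omega>)"
    and "fpmsd \<equiv> \<lambda>\<xi> \<omega>. pmsd_student lt ls \<xi> (X \<omega>) (y \<omega>) (Xu \<omega>)"
  defines "R \<equiv> cond_risk M F x0 y0 f"
    and "Rpd \<equiv> cond_risk M F x0 y0 fpd"
    and "C \<equiv> cond_cross_risk M F x0 y0 f fpd"
  defines "D \<equiv> \<lambda>\<omega>. R \<omega> + Rpd \<omega> - 2 * C \<omega>"
  assumes model: "distillation_model M X y Xu x0 y0"
    and lt: "lt > 0" and ls: "ls > 0"
    and finite_R: "finite_cond_risk M F x0 y0 f"
    and finite_Rpd: "finite_cond_risk M F x0 y0 fpd"
    and Rpmsd: "continuous_cond_risk_version M F x0 y0 fpmsd Rpmsd"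
  shows "AE \<omega> in M. D \<omega> > 0 \<longrightarrow>
    (\<exists>\<xi>. is_arg_min (\<lambda>\<xi>. Rpmsd \<xi> \<omega>) (\<lambda>_. True) \<xi>) \<and>
    (\<forall>\<xi>star. is_arg_min (\<lambda>\<xi>. Rpmsd \<xi> \<omega>) (\<lambda>_. True) \<xi>star \<longrightarrow>
       \<xi>star = (R \<omega> - C \<omega>) / D \<omega> \<and>
       Rpmsd \<xi>star \<omega> = R \<omega> - (R \<omega> - C \<omega>)\<^sup>2 / D \<omega> \<and>
       Rpmsd \<xi>star \<omega> = Rpd \<omega> - (Rpd \<omega> - C \<omega>)\<^sup>2 / D \<omega>)"
proof -
  interpret distillation_model M X y Xu x0 y0 by (rule model)
  let ?q = "\<lambda>\<xi> \<omega>. (1 - \<xi>)\<^sup>2 * R \<omega> + 2 * \<xi> * (1 - \<xi>) * C \<omega> + \<xi>\<^sup>2 * Rpd \<omega>"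
  have "AE \<omega> in M. Rpmsd \<xi> \<omega> = ?q \<xi> \<omega>" for \<xi>
  proof -
    have "AE \<omega> in M. Rpmsd \<xi> \<omega> = cond_risk M F x0 y0 (fpmsd \<xi>) \<omega>"
      using Rpmsd unfolding continuous_cond_risk_version_def by blast
    moreover have "AE \<omega> in M. cond_risk M F x0 y0 (fpmsd \<xi>) \<omega> = ?q \<xi> \<omega>"
      using finite_R finite_Rpd
      unfolding R_def C_def Rpd_def fpmsd_def F_def f_def fpd_def
      by (rule cond_risk_pmsd_quadratic[OF lt ls])
    ultimately show ?thesis by eventually_elim simp
  qed
  moreover have "AE \<omega> in M. continuous_on UNIV (\<lambda>\<xi>. Rpmsd \<xi> \<omega>)"
    using Rpmsd unfolding continuous_cond_risk_version_def by blast
  moreover have "AE \<omega> in M. continuous_on UNIV (\<lambda>\<xi>. ?q \<xi> \<omega>)"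
    by (intro AE_I2 continuous_intros)
  ultimately have "AE \<omega> in M. \<forall>\<xi>. Rpmsd \<xi> \<omega> = ?q \<xi> \<omega>"
    by (rule AE_eq_continuous_families)
  then show ?thesis
  proof eventually_elim
    case (elim \<omega>)
    show ?case
    proof
      assume D: "D \<omega> > 0"
      have D_eq: "R \<omega> + Rpd \<omega> - 2 * C \<omega> = D \<omega>" by (simp add: D_def)
      have nonzero: "D \<omega> \<noteq> 0" using D by simp
      note square = mixed_risk_complete_square[of "R \<omega>" "Rpd \<omega>" "C \<omega>", unfolded D_eq, OF nonzero]
      let ?z = "(R \<omega> - C \<omega>) / D \<omega>" and ?m = "R \<omega> - (R \<omega> - C \<omega>)\<^sup>2 / D \<omega>"
      have Rpmsd_eq: "Rpmsd \<xi> \<omega> = ?m + D \<omega> * (\<xi> - ?z)\<^sup>2" for \<xi>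
        using elim square(1) by simp
      have "?m = Rpd \<omega> - (Rpd \<omega> - C \<omega>)\<^sup>2 / D \<omega>"
        by (rule square(2))
      then show "(\<exists>\<xi>. is_arg_min (\<lambda>\<xi>. Rpmsd \<xi> \<omega>) (\<lambda>_. True) \<xi>) \<and>
          (\<forall>\<xi>star. is_arg_min (\<lambda>\<xi>. Rpmsd \<xi> \<omega>) (\<lambda>_. True) \<xi>star \<longrightarrow>
             \<xi>star = ?z \<and> Rpmsd \<xi>star \<omega> = ?m \<and>
             Rpmsd \<xi>star \<omega> = Rpd \<omega> - (Rpd \<omega> - C \<omega>)\<^sup>2 / D \<omega>)"
        unfolding Rpmsd_eq is_arg_min_square[OF D] by simp
    qed
  qed
qed

end
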